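(* Let $\Gamma=(F,G,\eta,\rho)$ be a right wide Morita context between the abelian categories $\mathcal A$ and $\mathcal B$ such that the functors $F$ and $G$ have right adjoints $F'$ and $G'$. Then there exist natural transformations $\eta':1_{\mathcal A}\to G'\circ F'$ and $\rho':1_{\mathcal B}\to F'\circ G'$ induced by $\Gamma$ such that $(F',G',\eta',\rho')$ is a left wide Morita context.
   Context: All functors are additive. A right wide Morita context between abelian categories $\mathcal A$ and $\mathcal B$ is a datum $(F,G,\eta,\rho)$ where $F:\mathcal B\to\mathcal A$ and $G:\mathcal A\to\mathcal B$ are right exact functors and $\eta:F\circ G\to 1_{\mathcal A}$, $\rho:G\circ F\to 1_{\mathcal B}$ are natural transformations with $G\eta=\rho G$ and $F\rho=\eta F$. A left wide Morita context is the dual notion: two left exact functors in opposite directions between two abelian categories, together with natural transformations from the identity functors to the two composites, satisfying the analogous compatibility equalities. Here $F':\mathcal A\to\mathcal B$ and $G':\mathcal B\to\mathcal A$, so for $(F',G',\eta',\rho')$ this means that $F'$ and $G'$ are left exact, $\eta'G'=G'\rho'$ and $\rho'F'=F'\eta'$. *)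

theory Defs
  imports "HOL-Algebra.Group"
begin

section \<open>Abelian categories\<close>

text \<open>
  A preadditive category is given by its objects, its arrows with source and target, identities,
  composition, the addition of parallel arrows, and the zero arrow between any two objects.
\<close>

record ('o, 'm) precat =
  obj :: "'o set"
  arr :: "'m set"
  src :: "'m \<Rightarrow> 'o"
  tgt :: "'m \<Rightarrow> 'o"
  ident :: "'o \<Rightarrow> 'm"
  cmp :: "'m \<Rightarrow> 'm \<Rightarrow> 'm" (infixr \<open>\<cdot>\<index>\<close> 75)
  add :: "'m \<Rightarrow> 'm \<Rightarrow> 'm"
  zero_arr :: "'o \<Rightarrow> 'o \<Rightarrow> 'm"

definition Hom :: "('o, 'm) precat \<Rightarrow> 'o \<Rightarrow> 'o \<Rightarrow> 'm set" where
  "Hom C x y = {f \<in> arr C. src C f = x \<and> tgt C f = y}"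

locale category =
  fixes C :: "('o, 'm) precat" (structure)
  assumes src_obj: "f \<in> arr C \<Longrightarrow> src C f \<in> obj C"
    and tgt_obj: "f \<in> arr C \<Longrightarrow> tgt C f \<in> obj C"
    and ident_Hom: "x \<in> obj C \<Longrightarrow> ident C x \<in> Hom C x x"
    and cmp_Hom: "f \<in> Hom C x y \<Longrightarrow> g \<in> Hom C y z \<Longrightarrow> g \<cdot> f \<in> Hom C x z"
    and cmp_assoc: "f \<in> Hom C w x \<Longrightarrow> g \<in> Hom C x y \<Longrightarrow> h \<in> Hom C y z
      \<Longrightarrow> (h \<cdot> g) \<cdot> f = h \<cdot> (g \<cdot> f)"
    and ident_left: "f \<in> Hom C x y \<Longrightarrow> ident C y \<cdot> f = f"
    and ident_right: "f \<in> Hom C x y \<Longrightarrow> f \<cdot> ident C x = f"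

definition Hom_group :: "('o, 'm) precat \<Rightarrow> 'o \<Rightarrow> 'o \<Rightarrow> 'm monoid" where
  "Hom_group C x y = \<lparr>carrier = Hom C x y, mult = add C, one = zero_arr C x y\<rparr>"

locale preadditive_category = category +
  assumes Hom_comm_group: "x \<in> obj C \<Longrightarrow> y \<in> obj C \<Longrightarrow> comm_group (Hom_group C x y)"
    and cmp_add_right: "f \<in> Hom C x y \<Longrightarrow> g \<in> Hom C x y \<Longrightarrow> h \<in> Hom C y z
      \<Longrightarrow> h \<cdot> add C f g = add C (h \<cdot> f) (h \<cdot> g)"
    and cmp_add_left: "f \<in> Hom C x y \<Longrightarrow> g \<in> Hom C y z \<Longrightarrow> h \<in> Hom C y z
      \<Longrightarrow> add C g h \<cdot> f = add C (g \<cdot> f) (h \<cdot> f)"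

definition zero_object :: "('o, 'm) precat \<Rightarrow> 'o \<Rightarrow> bool" where
  "zero_object C z \<longleftrightarrow> z \<in> obj C \<and>
     (\<forall>x\<in>obj C. (\<exists>!f. f \<in> Hom C z x) \<and> (\<exists>!f. f \<in> Hom C x z))"

definition biproduct ::
  "('o, 'm) precat \<Rightarrow> 'o \<Rightarrow> 'o \<Rightarrow> 'o \<Rightarrow> 'm \<Rightarrow> 'm \<Rightarrow> 'm \<Rightarrow> 'm \<Rightarrow> bool" where
  "biproduct C x y s i j p q \<longleftrightarrow> s \<in> obj C \<and>
     i \<in> Hom C x s \<and> j \<in> Hom C y s \<and> p \<in> Hom C s x \<and> q \<in> Hom C s y \<and>
     p \<cdot>\<^bsub>C\<^esub> i = ident C x \<and> q \<cdot>\<^bsub>C\<^esub> j = ident C y \<and>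
     p \<cdot>\<^bsub>C\<^esub> j = zero_arr C y x \<and> q \<cdot>\<^bsub>C\<^esub> i = zero_arr C x y \<and>
     add C (i \<cdot>\<^bsub>C\<^esub> p) (j \<cdot>\<^bsub>C\<^esub> q) = ident C s"

definition monic :: "('o, 'm) precat \<Rightarrow> 'm \<Rightarrow> bool" where
  "monic C m \<longleftrightarrow> m \<in> arr C \<and>
     (\<forall>x\<in>obj C. \<forall>f\<in>Hom C x (src C m). \<forall>g\<in>Hom C x (src C m).
        m \<cdot>\<^bsub>C\<^esub> f = m \<cdot>\<^bsub>C\<^esub> g \<longrightarrow> f = g)"

definition epic :: "('o, 'm) precat \<Rightarrow> 'm \<Rightarrow> bool" where
  "epic C e \<longleftrightarrow> e \<in> arr C \<and>
     (\<forall>x\<in>obj C. \<forall>f\<in>Hom C (tgt C e) x. \<forall>g\<in>Hom C (tgt C e) x.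
        f \<cdot>\<^bsub>C\<^esub> e = g \<cdot>\<^bsub>C\<^esub> e \<longrightarrow> f = g)"

definition is_kernel :: "('o, 'm) precat \<Rightarrow> 'm \<Rightarrow> 'm \<Rightarrow> bool" where
  "is_kernel C f k \<longleftrightarrow> f \<in> arr C \<and> k \<in> arr C \<and> tgt C k = src C f \<and>
     f \<cdot>\<^bsub>C\<^esub> k = zero_arr C (src C k) (tgt C f) \<and>
     (\<forall>x\<in>obj C. \<forall>h\<in>Hom C x (src C f). f \<cdot>\<^bsub>C\<^esub> h = zero_arr C x (tgt C f) \<longrightarrow>
        (\<exists>!u. u \<in> Hom C x (src C k) \<and> k \<cdot>\<^bsub>C\<^esub> u = h))"

definition is_cokernel :: "('o, 'm) precat \<Rightarrow> 'm \<Rightarrow> 'm \<Rightarrow> bool" where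
  "is_cokernel C f c \<longleftrightarrow> f \<in> arr C \<and> c \<in> arr C \<and> src C c = tgt C f \<and>
     c \<cdot>\<^bsub>C\<^esub> f = zero_arr C (src C f) (tgt C c) \<and>
     (\<forall>x\<in>obj C. \<forall>h\<in>Hom C (tgt C f) x. h \<cdot>\<^bsub>C\<^esub> f = zero_arr C (src C f) x \<longrightarrow>
        (\<exists>!u. u \<in> Hom C (tgt C c) x \<and> u \<cdot>\<^bsub>C\<^esub> c = h))"

locale abelian_category = preadditive_category +
  assumes ex_zero_object: "\<exists>z. zero_object C z"
    and ex_biproduct: "x \<in> obj C \<Longrightarrow> y \<in> obj C \<Longrightarrow> \<exists>s i j p q. biproduct C x y s i j p q"
    and ex_kernel: "f \<in> arr C \<Longrightarrow> \<exists>k. is_kernel C f k"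
    and ex_cokernel: "f \<in> arr C \<Longrightarrow> \<exists>c. is_cokernel C f c"
    and monic_normal: "monic C m \<Longrightarrow> \<exists>f. is_kernel C f m"
    and epic_normal: "epic C e \<Longrightarrow> \<exists>f. is_cokernel C f e"

section \<open>Exact sequences\<close>

definition is_image :: "('o, 'm) precat \<Rightarrow> 'm \<Rightarrow> 'm \<Rightarrow> bool" where
  "is_image C f m \<longleftrightarrow> (\<exists>c. is_cokernel C f c \<and> is_kernel C c m)"

text \<open>
  The image of \<open>f\<close> and the kernel of \<open>g\<close> are the same subobject of the middle object. Both are
  determined up to isomorphism over that object, so it suffices that some arrow represents both.
\<close>

definition exact_at :: "('o, 'm) precat \<Rightarrow> 'm \<Rightarrow> 'm \<Rightarrow> bool" where
  "exact_at C f g \<longleftrightarrow> (\<exists>m. is_image C f m \<and> is_kernel C g m)"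

text \<open>Exactness of \<open>0 \<rightarrow> x \<rightarrow> y \<rightarrow> z\<close> and of \<open>x \<rightarrow> y \<rightarrow> z \<rightarrow> 0\<close>.\<close>

definition left_exact_seq :: "('o, 'm) precat \<Rightarrow> 'm \<Rightarrow> 'm \<Rightarrow> bool" where
  "left_exact_seq C f g \<longleftrightarrow>
     (\<exists>n. zero_object C n \<and> exact_at C (zero_arr C n (src C f)) f) \<and> exact_at C f g"

definition right_exact_seq :: "('o, 'm) precat \<Rightarrow> 'm \<Rightarrow> 'm \<Rightarrow> bool" where
  "right_exact_seq C f g \<longleftrightarrow>
     exact_at C f g \<and> (\<exists>n. zero_object C n \<and> exact_at C g (zero_arr C (tgt C g) n))"

section \<open>Functors, natural transformations and adjunctions\<close>

record ('o1, 'm1, 'o2, 'm2) fctr =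
  on_obj :: "'o1 \<Rightarrow> 'o2"
  on_arr :: "'m1 \<Rightarrow> 'm2"

definition id_fctr :: "('o, 'm, 'o, 'm) fctr" where
  "id_fctr = \<lparr>on_obj = \<lambda>x. x, on_arr = \<lambda>f. f\<rparr>"

definition comp_fctr ::
  "('o2, 'm2, 'o3, 'm3) fctr \<Rightarrow> ('o1, 'm1, 'o2, 'm2) fctr \<Rightarrow> ('o1, 'm1, 'o3, 'm3) fctr"
  (infixl \<open>\<circ>\<^sub>F\<close> 70) where
  "S \<circ>\<^sub>F T = \<lparr>on_obj = \<lambda>x. on_obj S (on_obj T x), on_arr = \<lambda>f. on_arr S (on_arr T f)\<rparr>"

definition is_functor ::
  "('o1, 'm1) precat \<Rightarrow> ('o2, 'm2) precat \<Rightarrow> ('o1, 'm1, 'o2, 'm2) fctr \<Rightarrow> bool" where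
  "is_functor C D T \<longleftrightarrow> category C \<and> category D \<and>
     (\<forall>x\<in>obj C. on_obj T x \<in> obj D) \<and>
     (\<forall>x\<in>obj C. \<forall>y\<in>obj C. \<forall>f\<in>Hom C x y. on_arr T f \<in> Hom D (on_obj T x) (on_obj T y)) \<and>
     (\<forall>x\<in>obj C. on_arr T (ident C x) = ident D (on_obj T x)) \<and>
     (\<forall>x\<in>obj C. \<forall>y\<in>obj C. \<forall>z\<in>obj C. \<forall>f\<in>Hom C x y. \<forall>g\<in>Hom C y z.
        on_arr T (g \<cdot>\<^bsub>C\<^esub> f) = on_arr T g \<cdot>\<^bsub>D\<^esub> on_arr T f)"

definition additive_functor ::
  "('o1, 'm1) precat \<Rightarrow> ('o2, 'm2) precat \<Rightarrow> ('o1, 'm1, 'o2, 'm2) fctr \<Rightarrow> bool" where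
  "additive_functor C D T \<longleftrightarrow> is_functor C D T \<and>
     (\<forall>x\<in>obj C. \<forall>y\<in>obj C. \<forall>f\<in>Hom C x y. \<forall>g\<in>Hom C x y.
        on_arr T (add C f g) = add D (on_arr T f) (on_arr T g))"

definition left_exact_functor ::
  "('o1, 'm1) precat \<Rightarrow> ('o2, 'm2) precat \<Rightarrow> ('o1, 'm1, 'o2, 'm2) fctr \<Rightarrow> bool" where
  "left_exact_functor C D T \<longleftrightarrow> additive_functor C D T \<and>
     (\<forall>f g. left_exact_seq C f g \<longrightarrow> left_exact_seq D (on_arr T f) (on_arr T g))"

definition right_exact_functor ::
  "('o1, 'm1) precat \<Rightarrow> ('o2, 'm2) precat \<Rightarrow> ('o1, 'm1, 'o2, 'm2) fctr \<Rightarrow> bool" where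
  "right_exact_functor C D T \<longleftrightarrow> additive_functor C D T \<and>
     (\<forall>f g. right_exact_seq C f g \<longrightarrow> right_exact_seq D (on_arr T f) (on_arr T g))"

definition natural_transformation ::
  "('o1, 'm1) precat \<Rightarrow> ('o2, 'm2) precat \<Rightarrow> ('o1, 'm1, 'o2, 'm2) fctr \<Rightarrow>
   ('o1, 'm1, 'o2, 'm2) fctr \<Rightarrow> ('o1 \<Rightarrow> 'm2) \<Rightarrow> bool" where
  "natural_transformation C D S T \<tau> \<longleftrightarrow> is_functor C D S \<and> is_functor C D T \<and>
     (\<forall>x\<in>obj C. \<tau> x \<in> Hom D (on_obj S x) (on_obj T x)) \<and>
     (\<forall>x\<in>obj C. \<forall>y\<in>obj C. \<forall>f\<in>Hom C x y.
        \<tau> y \<cdot>\<^bsub>D\<^esub> on_arr S f = on_arr T f \<cdot>\<^bsub>D\<^esub> \<tau> x)"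

text \<open>
  \<open>L : C \<rightarrow> D\<close> is left adjoint to \<open>R : D \<rightarrow> C\<close> via the bijections
  \<open>\<phi> x y : Hom D (L x) y \<rightarrow> Hom C x (R y)\<close>, natural in \<open>x\<close> and \<open>y\<close>.
\<close>

definition adjunction ::
  "('o1, 'm1) precat \<Rightarrow> ('o2, 'm2) precat \<Rightarrow> ('o1, 'm1, 'o2, 'm2) fctr \<Rightarrow>
   ('o2, 'm2, 'o1, 'm1) fctr \<Rightarrow> ('o1 \<Rightarrow> 'o2 \<Rightarrow> 'm2 \<Rightarrow> 'm1) \<Rightarrow> bool" where
  "adjunction C D L R \<phi> \<longleftrightarrow> is_functor C D L \<and> is_functor D C R \<and>
     (\<forall>x\<in>obj C. \<forall>y\<in>obj D. bij_betw (\<phi> x y) (Hom D (on_obj L x) y) (Hom C x (on_obj R y))) \<and>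
     (\<forall>x\<in>obj C. \<forall>x'\<in>obj C. \<forall>y\<in>obj D. \<forall>f\<in>Hom D (on_obj L x) y. \<forall>u\<in>Hom C x' x.
        \<phi> x' y (f \<cdot>\<^bsub>D\<^esub> on_arr L u) = \<phi> x y f \<cdot>\<^bsub>C\<^esub> u) \<and>
     (\<forall>x\<in>obj C. \<forall>y\<in>obj D. \<forall>y'\<in>obj D. \<forall>f\<in>Hom D (on_obj L x) y. \<forall>v\<in>Hom D y y'.
        \<phi> x y' (v \<cdot>\<^bsub>D\<^esub> f) = on_arr R v \<cdot>\<^bsub>C\<^esub> \<phi> x y f)"

definition id_adj :: "'o \<Rightarrow> 'o \<Rightarrow> 'm \<Rightarrow> 'm" where
  "id_adj x y f = f"

text \<open>
  For adjunctions \<open>L \<stileturn> R\<close> via \<open>\<phi>\<close> and \<open>K \<stileturn> S\<close> via \<open>\<psi>\<close> with \<open>L : C \<rightarrow> D\<close> and \<open>K : D \<rightarrow> E\<close>,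
  the composite \<open>Hom E (K (L x)) z \<rightarrow> Hom D (L x) (S z) \<rightarrow> Hom C x (R (S z))\<close> exhibits
  \<open>K \<circ>\<^sub>F L\<close> as left adjoint to \<open>R \<circ>\<^sub>F S\<close>.
\<close>

definition comp_adj ::
  "('o1, 'm1, 'o2, 'm2) fctr \<Rightarrow> ('o1 \<Rightarrow> 'o2 \<Rightarrow> 'm2 \<Rightarrow> 'm1) \<Rightarrow>
   ('o3, 'm3, 'o2, 'm2) fctr \<Rightarrow> ('o2 \<Rightarrow> 'o3 \<Rightarrow> 'm3 \<Rightarrow> 'm2) \<Rightarrow>
   'o1 \<Rightarrow> 'o3 \<Rightarrow> 'm3 \<Rightarrow> 'm1" where
  "comp_adj L \<phi> S \<psi> x z f = \<phi> x (on_obj S z) (\<psi> (on_obj L x) z f)"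

text \<open>
  For adjunctions \<open>L \<stileturn> R\<close> via \<open>\<phi>\<close> and \<open>L' \<stileturn> R'\<close> via \<open>\<phi>'\<close> between \<open>C\<close> and \<open>D\<close>, a transformation
  \<open>\<sigma> : L \<rightarrow> L'\<close> of left adjoints induces by precomposition
  \<open>Hom C x (R' y) \<cong> Hom D (L' x) y \<rightarrow> Hom D (L x) y \<cong> Hom C x (R y)\<close>,
  hence by Yoneda a transformation \<open>\<tau> : R' \<rightarrow> R\<close> of right adjoints, its conjugate (or mate).
\<close>

definition conjugate ::
  "('o1, 'm1) precat \<Rightarrow> ('o2, 'm2) precat \<Rightarrow> ('o1 \<Rightarrow> 'o2 \<Rightarrow> 'm2 \<Rightarrow> 'm1) \<Rightarrow>
   ('o1, 'm1, 'o2, 'm2) fctr \<Rightarrow> ('o1 \<Rightarrow> 'o2 \<Rightarrow> 'm2 \<Rightarrow> 'm1) \<Rightarrow>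
   ('o1 \<Rightarrow> 'm2) \<Rightarrow> ('o2 \<Rightarrow> 'm1) \<Rightarrow> bool" where
  "conjugate C D \<phi> L' \<phi>' \<sigma> \<tau> \<longleftrightarrow>
     (\<forall>x\<in>obj C. \<forall>y\<in>obj D. \<forall>f\<in>Hom D (on_obj L' x) y.
        \<phi> x y (f \<cdot>\<^bsub>D\<^esub> \<sigma> x) = \<tau> y \<cdot>\<^bsub>C\<^esub> \<phi>' x y f)"

section \<open>Wide Morita contexts\<close>

locale right_wide_morita_context =
  A: abelian_category A + B: abelian_category B
  for A :: "('oa, 'ma) precat" and B :: "('ob, 'mb) precat" +
  fixes F :: "('ob, 'mb, 'oa, 'ma) fctr"
    and G :: "('oa, 'ma, 'ob, 'mb) fctr"
    and \<eta> :: "'oa \<Rightarrow> 'ma"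
    and \<rho> :: "'ob \<Rightarrow> 'mb"
  assumes F_right_exact: "right_exact_functor B A F"
    and G_right_exact: "right_exact_functor A B G"
    and \<eta>_natural: "natural_transformation A A (F \<circ>\<^sub>F G) id_fctr \<eta>"
    and \<rho>_natural: "natural_transformation B B (G \<circ>\<^sub>F F) id_fctr \<rho>"
    and G_\<eta>: "a \<in> obj A \<Longrightarrow> on_arr G (\<eta> a) = \<rho> (on_obj G a)"
    and F_\<rho>: "b \<in> obj B \<Longrightarrow> on_arr F (\<rho> b) = \<eta> (on_obj F b)"

locale left_wide_morita_context =
  A: abelian_category A + B: abelian_category B
  for A :: "('oa, 'ma) precat" and B :: "('ob, 'mb) precat" +
  fixes F :: "('oa, 'ma, 'ob, 'mb) fctr"
    and G :: "('ob, 'mb, 'oa, 'ma) fctr"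
    and \<eta> :: "'oa \<Rightarrow> 'ma"
    and \<rho> :: "'ob \<Rightarrow> 'mb"
  assumes F_left_exact: "left_exact_functor A B F"
    and G_left_exact: "left_exact_functor B A G"
    and \<eta>_natural: "natural_transformation A A id_fctr (G \<circ>\<^sub>F F) \<eta>"
    and \<rho>_natural: "natural_transformation B B id_fctr (F \<circ>\<^sub>F G) \<rho>"
    and \<eta>_G: "b \<in> obj B \<Longrightarrow> \<eta> (on_obj G b) = on_arr G (\<rho> b)"
    and \<rho>_F: "a \<in> obj A \<Longrightarrow> \<rho> (on_obj F a) = on_arr F (\<eta> a)"

end

theory Submission
  imports Defs
begin

text \<open>
  The transformations \<open>\<eta>'\<close> and \<open>\<rho>'\<close> are the adjoint transposes of \<open>\<eta>\<close> and \<open>\<rho>\<close> along the composite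
  adjunctions. With \<open>\<epsilon> : G (G' b) \<rightarrow> b\<close> the counit of \<open>G \<stileturn> G'\<close>, naturality of the transposes shows
  that \<open>G' (\<rho>' b)\<close> corresponds to \<open>\<rho> b \<cdot> G (F \<epsilon>)\<close>, which equals
  \<open>\<epsilon> \<cdot> \<rho> (G (G' b)) = \<epsilon> \<cdot> G (\<eta> (G' b))\<close>; this in turn corresponds to \<open>\<eta>' (G' b)\<close>. The other equality
  is the same argument in the context with \<open>\<A>\<close> and \<open>\<B>\<close> exchanged. In an abelian category
  \<open>0 \<rightarrow> x \<rightarrow> y \<rightarrow> z\<close> is exact iff the first arrow is a kernel of the second, and right adjoints
  preserve kernels.
\<close>

section \<open>Hom-sets and zero arrows\<close>

lemma HomD:
  assumes "f \<in> Hom C x y"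
  shows "f \<in> arr C" "src C f = x" "tgt C f = y"
  using assms by (simp_all add: Hom_def)

lemma (in category) Hom_obj:
  assumes "f \<in> Hom C x y"
  shows "x \<in> obj C" "y \<in> obj C"
  using assms src_obj tgt_obj by (auto simp: Hom_def)

context preadditive_category
begin

lemma zero_arr_Hom:
  assumes "x \<in> obj C" "y \<in> obj C"
  shows "zero_arr C x y \<in> Hom C x y"
proof -
  interpret H: comm_group "Hom_group C x y" by (rule Hom_comm_group[OF assms])
  show ?thesis using H.one_closed by (simp add: Hom_group_def)
qed

lemma add_zero_arr:
  assumes "f \<in> Hom C x y"
  shows "add C (zero_arr C x y) f = f"
proof -
  interpret H: comm_group "Hom_group C x y" by (rule Hom_comm_group[OF Hom_obj[OF assms]])
  show ?thesis using H.l_one[of f] assms by (simp add: Hom_group_def)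
qed

text \<open>Cancellation in the group of parallel arrows. Additivity of composition, and later of
  functors, only gives that the image of a zero arrow is equal to its own double; this turns that
  into preservation of zero arrows.\<close>

lemma add_idem_zero:
  assumes "f \<in> Hom C x y" "add C f f = f"
  shows "f = zero_arr C x y"
proof -
  interpret H: comm_group "Hom_group C x y" by (rule Hom_comm_group[OF Hom_obj[OF assms(1)]])
  show ?thesis using H.r_cancel_one[of f f] assms by (simp add: Hom_group_def)
qed

lemma cmp_zero_right:
  assumes "h \<in> Hom C y z" "x \<in> obj C"
  shows "h \<cdot> zero_arr C x y = zero_arr C x z"
proof (rule add_idem_zero)
  have 0: "zero_arr C x y \<in> Hom C x y"
    by (rule zero_arr_Hom[OF assms(2) Hom_obj(1)[OF assms(1)]])
  show "h \<cdot> zero_arr C x y \<in> Hom C x z" by (rule cmp_Hom[OF 0 assms(1)])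
  show "add C (h \<cdot> zero_arr C x y) (h \<cdot> zero_arr C x y) = h \<cdot> zero_arr C x y"
    using cmp_add_right[OF 0 0 assms(1)] add_zero_arr[OF 0] by simp
qed

lemma cmp_zero_left:
  assumes "f \<in> Hom C x y" "z \<in> obj C"
  shows "zero_arr C y z \<cdot> f = zero_arr C x z"
proof (rule add_idem_zero)
  have 0: "zero_arr C y z \<in> Hom C y z"
    by (rule zero_arr_Hom[OF Hom_obj(2)[OF assms(1)] assms(2)])
  show "zero_arr C y z \<cdot> f \<in> Hom C x z" by (rule cmp_Hom[OF assms(1) 0])
  show "add C (zero_arr C y z \<cdot> f) (zero_arr C y z \<cdot> f) = zero_arr C y z \<cdot> f"
    using cmp_add_left[OF assms(1) 0 0] add_zero_arr[OF 0] by simp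
qed

section \<open>Kernels and cokernels\<close>

lemma is_kernel_Hom:
  assumes "is_kernel C f k"
  shows "f \<in> Hom C (tgt C k) (tgt C f)" "k \<in> Hom C (src C k) (tgt C k)"
  using assms by (auto simp: is_kernel_def Hom_def)

lemma is_cokernel_Hom:
  assumes "is_cokernel C f c"
  shows "f \<in> Hom C (src C f) (tgt C f)" "c \<in> Hom C (tgt C f) (tgt C c)"
  using assms by (auto simp: is_cokernel_def Hom_def)

lemma is_kernel_zero: "is_kernel C f k \<Longrightarrow> f \<cdot> k = zero_arr C (src C k) (tgt C f)"
  by (simp add: is_kernel_def)

lemma is_cokernel_zero: "is_cokernel C f c \<Longrightarrow> c \<cdot> f = zero_arr C (src C f) (tgt C c)"
  by (simp add: is_cokernel_def)

lemma is_kernel_ex1: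
  assumes "is_kernel C f k" "h \<in> Hom C x (tgt C k)" "f \<cdot> h = zero_arr C x (tgt C f)"
  shows "\<exists>!u. u \<in> Hom C x (src C k) \<and> k \<cdot> u = h"
  using assms Hom_obj(1)[OF assms(2)] by (simp add: is_kernel_def)

lemma is_cokernel_ex1:
  assumes "is_cokernel C f c" "h \<in> Hom C (tgt C f) x" "h \<cdot> f = zero_arr C (src C f) x"
  shows "\<exists>!u. u \<in> Hom C (tgt C c) x \<and> u \<cdot> c = h"
  using assms Hom_obj(2)[OF assms(2)] by (simp add: is_cokernel_def)

text \<open>Unique factorization is split into existence and left cancellability of
  \<open>k\<close>. The objects are variables, so that the rule also applies when they are images
  under functors.\<close>

lemma is_kernelI:
  assumes "f \<in> Hom C y z" "k \<in> Hom C w y" "f \<cdot> k = zero_arr C w z"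
    and "\<And>x h. h \<in> Hom C x y \<Longrightarrow> f \<cdot> h = zero_arr C x z \<Longrightarrow> \<exists>u. u \<in> Hom C x w \<and> k \<cdot> u = h"
    and "\<And>x u v. u \<in> Hom C x w \<Longrightarrow> v \<in> Hom C x w \<Longrightarrow> k \<cdot> u = k \<cdot> v \<Longrightarrow> u = v"
  shows "is_kernel C f k"
  unfolding is_kernel_def HomD[OF assms(1)] HomD[OF assms(2)]
proof (intro conjI ballI impI)
  fix x h assume "x \<in> obj C" "h \<in> Hom C x y" "f \<cdot> h = zero_arr C x z"
  then show "\<exists>!u. u \<in> Hom C x w \<and> k \<cdot> u = h" using assms(4,5) by metis
qed (use assms in \<open>simp_all add: Hom_def\<close>)

text \<open>The uniqueness clause concerns factorizations of arrows killed by \<open>f\<close>. The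
  common composite is such an arrow, because \<open>f\<close> already kills
  \<open>k\<close>.\<close>

lemma is_kernel_inj:
  assumes "is_kernel C f k" "u \<in> Hom C x (src C k)" "v \<in> Hom C x (src C k)" "k \<cdot> u = k \<cdot> v"
  shows "u = v"
proof -
  note fk = is_kernel_Hom[OF assms(1)]
  have "f \<cdot> (k \<cdot> v) = zero_arr C x (tgt C f)"
    unfolding cmp_assoc[OF assms(3) fk(2,1), symmetric] is_kernel_zero[OF assms(1)]
    by (rule cmp_zero_left[OF assms(3) Hom_obj(2)[OF fk(1)]])
  from is_kernel_ex1[OF assms(1) cmp_Hom[OF assms(3) fk(2)] this] assms(2-4)
  show ?thesis by metis
qed

text \<open>Since \<open>f\<close> kills \<open>k\<close>, it factors as \<open>u \<cdot> c\<close>.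
  Whatever \<open>c\<close> kills is therefore killed by \<open>f\<close> and factors through
  \<open>k\<close>.\<close>

lemma is_kernel_cokernel:
  assumes k: "is_kernel C f k" and c: "is_cokernel C k c"
  shows "is_kernel C c k"
proof (rule is_kernelI[OF is_cokernel_Hom(2,1)[OF c] is_cokernel_zero[OF c]])
  note fk = is_kernel_Hom[OF k] and ck = is_cokernel_Hom[OF c]
  fix x h assume h: "h \<in> Hom C x (tgt C k)" "c \<cdot> h = zero_arr C x (tgt C c)"
  obtain u where u: "u \<in> Hom C (tgt C c) (tgt C f)" "u \<cdot> c = f"
    using is_cokernel_ex1[OF c fk(1) is_kernel_zero[OF k]] by blast
  have "f \<cdot> h = u \<cdot> (c \<cdot> h)" using cmp_assoc[OF h(1) ck(2) u(1)] u(2) by simp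
  also have "\<dots> = zero_arr C x (tgt C f)"
    unfolding h(2) by (rule cmp_zero_right[OF u(1) Hom_obj(1)[OF h(1)]])
  finally show "\<exists>u. u \<in> Hom C x (src C k) \<and> k \<cdot> u = h"
    using is_kernel_ex1[OF k h(1)] by blast
qed (rule is_kernel_inj[OF k])

text \<open>As kernels of the same \<open>c\<close>, the arrows \<open>f\<close> and
  \<open>m\<close> factor through each other and represent the same subobject. This identifies the
  arrow \<open>m\<close> chosen in \<open>exact_at\<close> with the first arrow of the
  sequence.\<close>

lemma is_kernel_transfer:
  assumes f: "is_kernel C c f" and m: "is_kernel C c m" and g: "is_kernel C g m"
  shows "is_kernel C g f"
proof -
  note cf = is_kernel_Hom[OF f] and cm = is_kernel_Hom[OF m] and gm = is_kernel_Hom[OF g]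
  have t: "tgt C m = tgt C f" using f m by (simp add: is_kernel_def)
  obtain u where u: "u \<in> Hom C (src C f) (src C m)" "m \<cdot> u = f"
    using is_kernel_ex1[OF m cf(2)[folded t] is_kernel_zero[OF f]] by blast
  obtain v where v: "v \<in> Hom C (src C m) (src C f)" "f \<cdot> v = m"
    using is_kernel_ex1[OF f cm(2)[unfolded t] is_kernel_zero[OF m]] by blast
  show ?thesis
  proof (rule is_kernelI[OF gm(1)[unfolded t] cf(2)])
    show "g \<cdot> f = zero_arr C (src C f) (tgt C g)"
      using cmp_assoc[OF u(1) gm(2,1)] u is_kernel_zero[OF g]
        cmp_zero_left[OF u(1) Hom_obj(2)[OF gm(1)]] by simp
  next
    fix x h assume h: "h \<in> Hom C x (tgt C f)" "g \<cdot> h = zero_arr C x (tgt C g)"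
    obtain w where w: "w \<in> Hom C x (src C m)" "m \<cdot> w = h"
      using is_kernel_ex1[OF g h(1)[folded t] h(2)] by blast
    have "f \<cdot> (v \<cdot> w) = h" using cmp_assoc[OF w(1) v(1) cf(2)] v(2) w(2) by simp
    then show "\<exists>u. u \<in> Hom C x (src C f) \<and> f \<cdot> u = h" using cmp_Hom[OF w(1) v(1)] by blast
  qed (rule is_kernel_inj[OF f])
qed

section \<open>Left exact sequences as kernels\<close>

lemma is_cokernel_ident:
  assumes "x \<in> obj C" "y \<in> obj C"
  shows "is_cokernel C (zero_arr C x y) (ident C y)"
proof -
  have 0: "zero_arr C x y \<in> Hom C x y" by (rule zero_arr_Hom[OF assms])
  have i: "ident C y \<in> Hom C y y" by (rule ident_Hom[OF assms(2)])
  show ?thesis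
    unfolding is_cokernel_def HomD[OF 0] HomD[OF i]
  proof (intro conjI ballI impI)
    fix z h assume "z \<in> obj C" "h \<in> Hom C y z"
    then show "\<exists>!u. u \<in> Hom C y z \<and> u \<cdot> ident C y = h" using ident_right by metis
  qed (use HomD(1)[OF 0] HomD(1)[OF i] ident_left[OF 0] in simp_all)
qed

text \<open>A left cancellable arrow kills only zero arrows, and these factor through
  \<open>n\<close>; the factorization is unique because \<open>n\<close> is terminal.\<close>

lemma is_kernel_zero_object:
  assumes n: "zero_object C n" and f: "f \<in> Hom C x y"
    and inj: "\<And>w u v. u \<in> Hom C w x \<Longrightarrow> v \<in> Hom C w x \<Longrightarrow> f \<cdot> u = f \<cdot> v \<Longrightarrow> u = v"
  shows "is_kernel C f (zero_arr C n x)"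
proof -
  have n': "n \<in> obj C" using n by (simp add: zero_object_def)
  have 0: "zero_arr C n x \<in> Hom C n x" by (rule zero_arr_Hom[OF n' Hom_obj(1)[OF f]])
  show ?thesis
  proof (rule is_kernelI[OF f 0 cmp_zero_right[OF f n']])
    fix w h assume h: "h \<in> Hom C w x" "f \<cdot> h = zero_arr C w y"
    have w: "w \<in> obj C" by (rule Hom_obj(1)[OF h(1)])
    have "h = zero_arr C w x"
      by (rule inj[OF h(1) zero_arr_Hom[OF w Hom_obj(1)[OF f]]])
        (simp add: h(2) cmp_zero_right[OF f w])
    moreover have "zero_arr C n x \<cdot> zero_arr C w n = zero_arr C w x"
      by (rule cmp_zero_right[OF 0 w])
    ultimately show "\<exists>u. u \<in> Hom C w n \<and> zero_arr C n x \<cdot> u = h"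
      using zero_arr_Hom[OF w n'] by blast
  next
    fix w u v assume "u \<in> Hom C w n" "v \<in> Hom C w n"
    then show "u = v" using n Hom_obj(1)[of u w n] unfolding zero_object_def by blast
  qed
qed

text \<open>The cokernel \<open>c\<close> of a zero arrow has a left inverse, so its kernel
  \<open>m\<close> is zero. As \<open>m\<close> is also a kernel of \<open>f\<close>, the arrow
  \<open>f\<close> kills only zero arrows, and subtraction turns this into left
  cancellation.\<close>

lemma exact_at_zero_imp_monic:
  assumes n: "n \<in> obj C" and ex: "exact_at C (zero_arr C n (src C f)) f"
  shows "monic C f"
proof -
  let ?x = "src C f"
  obtain m c where c: "is_cokernel C (zero_arr C n ?x) c" and mc: "is_kernel C c m"
    and m: "is_kernel C f m"
    using ex by (auto simp: exact_at_def is_image_def)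
  have f: "f \<in> Hom C ?x (tgt C f)" using m by (simp add: is_kernel_def Hom_def)
  have x: "?x \<in> obj C" by (rule Hom_obj(1)[OF f])
  have tm: "tgt C m = ?x" using m by (simp add: is_kernel_def)
  note 0 = zero_arr_Hom[OF n x] and mH = is_kernel_Hom(2)[OF m, unfolded tm]
  note cH = is_cokernel_Hom(2)[OF c, unfolded HomD(3)[OF 0]]
  \<comment> \<open>The identity of the source of \<open>f\<close> composes with the zero arrow to
    zero, hence factors through its cokernel \<open>c\<close>.\<close>
  obtain r where r: "r \<in> Hom C (tgt C c) ?x" "r \<cdot> c = ident C ?x"
    using is_cokernel_ex1[OF c, of "ident C ?x" ?x] ident_Hom[OF x] ident_left[OF 0]
    by (auto simp: HomD[OF 0])
  have "m = r \<cdot> (c \<cdot> m)" using cmp_assoc[OF mH cH r(1)] r(2) ident_left[OF mH] by simp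
  also have "\<dots> = zero_arr C (src C m) ?x"
    unfolding is_kernel_zero[OF mc] by (rule cmp_zero_right[OF r(1) Hom_obj(1)[OF mH]])
  finally have m0: "m = zero_arr C (src C m) ?x" .
  have null: "u = zero_arr C w ?x" if u: "u \<in> Hom C w ?x" "f \<cdot> u = zero_arr C w (tgt C f)" for u w
  proof -
    obtain t where t: "t \<in> Hom C w (src C m)" "m \<cdot> t = u"
      using is_kernel_ex1[OF m u(1)[folded tm] u(2)] by blast
    have "m \<cdot> t = zero_arr C w ?x" by (subst m0) (rule cmp_zero_left[OF t(1) x])
    with t show ?thesis by simp
  qed
  show ?thesis
    unfolding monic_def
  proof (intro conjI ballI impI HomD(1)[OF f])
    fix w u v assume w: "w \<in> obj C" and u: "u \<in> Hom C w ?x" and v: "v \<in> Hom C w ?x"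
      and eq: "f \<cdot> u = f \<cdot> v"
    interpret X: comm_group "Hom_group C w ?x" by (rule Hom_comm_group[OF w x])
    have cX: "carrier (Hom_group C w ?x) = Hom C w ?x" "mult (Hom_group C w ?x) = add C"
      "one (Hom_group C w ?x) = zero_arr C w ?x" by (simp_all add: Hom_group_def)
    \<comment> \<open>The additive inverse of \<open>v\<close>: the difference
      \<open>add C u i\<close> is killed by \<open>f\<close>, so \<open>null\<close> applies to
      it.\<close>
    define i where "i = m_inv (Hom_group C w ?x) v"
    have i: "i \<in> Hom C w ?x" using X.inv_closed v by (simp add: i_def cX)
    have vi: "add C v i = zero_arr C w ?x" using X.r_inv v by (simp add: i_def cX)
    have "f \<cdot> add C u i = f \<cdot> add C v i"
      by (simp add: cmp_add_right[OF u i f] cmp_add_right[OF v i f] eq)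
    also have "\<dots> = zero_arr C w (tgt C f)" by (simp add: vi cmp_zero_right[OF f w])
    finally have "add C u i = zero_arr C w ?x"
      using null[of "add C u i" w] X.m_closed u i by (simp add: cX)
    then show "u = v" using vi X.right_cancel[of i u v] u v i by (simp add: cX)
  qed
qed

end

text \<open>This replaces exactness, with its chosen images and zero objects, by one universal
  property, which can be carried across an adjunction.\<close>

lemma (in abelian_category) left_exact_seq_iff_kernel:
  "left_exact_seq C f g \<longleftrightarrow> is_kernel C g f"
proof
  assume "left_exact_seq C f g"
  then obtain n m c where n: "zero_object C n" and zf: "exact_at C (zero_arr C n (src C f)) f"
    and c: "is_cokernel C f c" and mc: "is_kernel C c m" and m: "is_kernel C g m"
    unfolding left_exact_seq_def exact_at_def[of C f g] is_image_def by blast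
  have "monic C f"
    by (rule exact_at_zero_imp_monic[OF _ zf]) (use n in \<open>simp add: zero_object_def\<close>)
  \<comment> \<open>Normality of monics makes \<open>f\<close> a kernel, hence a kernel of its own
    cokernel \<open>c\<close>. The image \<open>m\<close> is a kernel of the same \<open>c\<close>,
    so \<open>f\<close> inherits from \<open>m\<close> that it is a kernel of
    \<open>g\<close>.\<close>
  then obtain e where "is_kernel C e f" using monic_normal by blast
  from is_kernel_transfer[OF is_kernel_cokernel[OF this c] mc m] show "is_kernel C g f" .
next
  assume k: "is_kernel C g f"
  note f = is_kernel_Hom(2)[OF k]
  obtain n where n: "zero_object C n" using ex_zero_object by blast
  have n': "n \<in> obj C" using n by (simp add: zero_object_def)
  have x: "src C f \<in> obj C" by (rule Hom_obj(1)[OF f])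
  \<comment> \<open>The identity is a cokernel of the zero arrow out of \<open>n\<close>, so this
    zero arrow is its own image; it is also a kernel of the cancellable arrow
    \<open>f\<close>.\<close>
  have "is_kernel C (ident C (src C f)) (zero_arr C n (src C f))"
    by (rule is_kernel_zero_object[OF n ident_Hom[OF x]]) (simp add: ident_left)
  then have "exact_at C (zero_arr C n (src C f)) f"
    using is_cokernel_ident[OF n' x] is_kernel_zero_object[OF n f is_kernel_inj[OF k]]
    by (auto simp: exact_at_def is_image_def)
  moreover obtain c where "is_cokernel C f c" using ex_cokernel[OF HomD(1)[OF f]] by blast
  then have "exact_at C f g"
    using k is_kernel_cokernel[OF k] by (auto simp: exact_at_def is_image_def)
  ultimately show "left_exact_seq C f g" using n by (auto simp: left_exact_seq_def)
qed

section \<open>Functors and additivity\<close>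

context
  fixes C :: "('o1, 'm1) precat" and D :: "('o2, 'm2) precat" and T :: "('o1, 'm1, 'o2, 'm2) fctr"
  assumes T: "is_functor C D T"
begin

lemma functor_obj: "x \<in> obj C \<Longrightarrow> on_obj T x \<in> obj D"
  using T by (simp add: is_functor_def)

lemma functor_Hom: "f \<in> Hom C x y \<Longrightarrow> on_arr T f \<in> Hom D (on_obj T x) (on_obj T y)"
  using T category.Hom_obj[of C f x y] by (simp add: is_functor_def)

lemma functor_ident: "x \<in> obj C \<Longrightarrow> on_arr T (ident C x) = ident D (on_obj T x)"
  using T by (simp add: is_functor_def)

lemma functor_cmp:
  "f \<in> Hom C x y \<Longrightarrow> g \<in> Hom C y z \<Longrightarrow> on_arr T (g \<cdot>\<^bsub>C\<^esub> f) = on_arr T g \<cdot>\<^bsub>D\<^esub> on_arr T f"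
  using T category.Hom_obj[of C f x y] category.Hom_obj[of C g y z]
  unfolding is_functor_def by metis

end

lemma is_functor_id: "category C \<Longrightarrow> is_functor C C id_fctr"
  by (simp add: is_functor_def id_fctr_def)

lemma is_functor_comp:
  assumes S: "is_functor D E S" and T: "is_functor C D T"
  shows "is_functor C E (S \<circ>\<^sub>F T)"
  unfolding is_functor_def comp_fctr_def fctr.simps
proof (intro conjI ballI)
  show "category C" "category E" using S T by (simp_all add: is_functor_def)
  fix x y z f g assume f: "f \<in> Hom C x y" and g: "g \<in> Hom C y z"
  show "on_arr S (on_arr T (g \<cdot>\<^bsub>C\<^esub> f)) = on_arr S (on_arr T g) \<cdot>\<^bsub>E\<^esub> on_arr S (on_arr T f)"
    by (simp add: functor_cmp[OF T f g] functor_cmp[OF S functor_Hom[OF T f] functor_Hom[OF T g]])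
qed (simp_all add: functor_obj[OF S] functor_obj[OF T] functor_Hom[OF S] functor_Hom[OF T]
    functor_ident[OF S] functor_ident[OF T])

lemma additive_functor_zero:
  assumes C: "preadditive_category C" and D: "preadditive_category D"
    and T: "additive_functor C D T" and x: "x \<in> obj C" and y: "y \<in> obj C"
  shows "on_arr T (zero_arr C x y) = zero_arr D (on_obj T x) (on_obj T y)"
proof -
  have fT: "is_functor C D T" using T by (simp add: additive_functor_def)
  note 0 = preadditive_category.zero_arr_Hom[OF C x y]
  have "on_arr T (add C (zero_arr C x y) (zero_arr C x y))
      = add D (on_arr T (zero_arr C x y)) (on_arr T (zero_arr C x y))"
    using T x y 0 by (simp add: additive_functor_def)
  then show ?thesis
    using preadditive_category.add_idem_zero[OF D functor_Hom[OF fT 0]]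
      preadditive_category.add_zero_arr[OF C 0] by simp
qed

section \<open>Adjunctions and left exactness of right adjoints\<close>

context
  fixes C :: "('o1, 'm1) precat" and D :: "('o2, 'm2) precat"
    and L :: "('o1, 'm1, 'o2, 'm2) fctr" and R :: "('o2, 'm2, 'o1, 'm1) fctr" and \<phi>
  assumes adj: "adjunction C D L R \<phi>"
begin

lemma adj_functors: "is_functor C D L" "is_functor D C R"
  using adj by (simp_all add: adjunction_def)

lemma adj_bij:
  "x \<in> obj C \<Longrightarrow> y \<in> obj D \<Longrightarrow> bij_betw (\<phi> x y) (Hom D (on_obj L x) y) (Hom C x (on_obj R y))"
  using adj by (simp add: adjunction_def)

lemma adj_Hom:
  assumes "x \<in> obj C" "f \<in> Hom D (on_obj L x) y"
  shows "\<phi> x y f \<in> Hom C x (on_obj R y)"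
proof -
  have "y \<in> obj D"
    using category.Hom_obj(2)[OF _ assms(2)] adj_functors(1) by (simp add: is_functor_def)
  from bij_betw_apply[OF adj_bij[OF assms(1) this] assms(2)] show ?thesis .
qed

lemma adj_surj:
  assumes "y \<in> obj D" "g \<in> Hom C x (on_obj R y)"
  obtains f where "f \<in> Hom D (on_obj L x) y" "\<phi> x y f = g"
proof -
  have "x \<in> obj C"
    using category.Hom_obj(1)[OF _ assms(2)] adj_functors(1) by (simp add: is_functor_def)
  from adj_bij[OF this assms(1)] assms(2) have "g \<in> \<phi> x y ` Hom D (on_obj L x) y"
    by (simp add: bij_betw_def)
  then show ?thesis using that by (auto simp: image_iff)
qed

lemma adj_inj:
  assumes "x \<in> obj C" "f \<in> Hom D (on_obj L x) y" "g \<in> Hom D (on_obj L x) y" "\<phi> x y f = \<phi> x y g"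
  shows "f = g"
proof -
  have "y \<in> obj D"
    using category.Hom_obj(2)[OF _ assms(2)] adj_functors(1) by (simp add: is_functor_def)
  from adj_bij[OF assms(1) this] assms(2-4) show ?thesis
    unfolding bij_betw_def inj_on_def by blast
qed

lemma adj_nat_left:
  assumes "f \<in> Hom D (on_obj L x) y" "u \<in> Hom C x' x"
  shows "\<phi> x' y (f \<cdot>\<^bsub>D\<^esub> on_arr L u) = \<phi> x y f \<cdot>\<^bsub>C\<^esub> u"
proof -
  have "category C" "category D" using adj_functors(1) by (simp_all add: is_functor_def)
  with assms show ?thesis
    using adj category.Hom_obj[of C u x' x] category.Hom_obj[of D f "on_obj L x" y]
    by (simp add: adjunction_def)
qed

lemma adj_nat_right:
  assumes "x \<in> obj C" "f \<in> Hom D (on_obj L x) y" "v \<in> Hom D y y'"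
  shows "\<phi> x y' (v \<cdot>\<^bsub>D\<^esub> f) = on_arr R v \<cdot>\<^bsub>C\<^esub> \<phi> x y f"
proof -
  have "category D" using adj_functors(1) by (simp add: is_functor_def)
  with assms show ?thesis
    using adj category.Hom_obj[of D v y y'] by (simp add: adjunction_def)
qed

text \<open>Arrows from \<open>x\<close> into \<open>on_obj R y\<close> are transposes of arrows
  from \<open>on_obj L x\<close> into \<open>y\<close>. Naturality in the second argument matches
  composition with \<open>on_arr R k\<close> to composition with \<open>k\<close>, so the universal
  property of \<open>k\<close> carries over.\<close>

lemma right_adjoint_preserves_kernel:
  assumes C: "preadditive_category C" and D: "preadditive_category D"
    and R: "additive_functor D C R" and k: "is_kernel D g k"
  shows "is_kernel C (on_arr R g) (on_arr R k)"
proof -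
  interpret C: preadditive_category C by fact
  interpret D: preadditive_category D by fact
  define w y z where "w = src D k" "y = tgt D k" "z = tgt D g"
  have gH: "g \<in> Hom D y z" and kH: "k \<in> Hom D w y"
    using D.is_kernel_Hom[OF k] by (simp_all add: w_y_z_def)
  note o = D.Hom_obj[OF gH] D.Hom_obj[OF kH]
  note zeroR = additive_functor_zero[OF D C R]
  show ?thesis
  proof (rule C.is_kernelI[OF functor_Hom[OF adj_functors(2) gH] functor_Hom[OF adj_functors(2) kH]])
    show "on_arr R g \<cdot>\<^bsub>C\<^esub> on_arr R k = zero_arr C (on_obj R w) (on_obj R z)"
      using functor_cmp[OF adj_functors(2) kH gH] D.is_kernel_zero[OF k] zeroR[of w z] o
      by (simp add: w_y_z_def)
  next
    fix x h
    assume h: "h \<in> Hom C x (on_obj R y)" "on_arr R g \<cdot>\<^bsub>C\<^esub> h = zero_arr C x (on_obj R z)"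
    have x: "x \<in> obj C" by (rule C.Hom_obj(1)[OF h(1)])
    have Lx: "on_obj L x \<in> obj D" by (rule functor_obj[OF adj_functors(1) x])
    obtain h' where h': "h' \<in> Hom D (on_obj L x) y" "\<phi> x y h' = h"
      by (rule adj_surj[OF o(1) h(1)])
    \<comment> \<open>The transpose of zero must be shown to be zero. Writing zero as a composite
      through \<open>y\<close> makes naturality applicable, and additivity of \<open>R\<close> then
      gives a zero arrow in \<open>C\<close>.\<close>
    have "\<phi> x z (zero_arr D (on_obj L x) z) = \<phi> x z (zero_arr D y z \<cdot>\<^bsub>D\<^esub> h')"
      by (simp add: D.cmp_zero_left[OF h'(1) o(2)])
    also have "\<dots> = zero_arr C (on_obj R y) (on_obj R z) \<cdot>\<^bsub>C\<^esub> h"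
      by (simp add: adj_nat_right[OF x h'(1) D.zero_arr_Hom[OF o(1,2)]] h'(2) zeroR[OF o(1,2)])
    also have "\<dots> = zero_arr C x (on_obj R z)"
      by (rule C.cmp_zero_left[OF h(1) functor_obj[OF adj_functors(2) o(2)]])
    also have "\<dots> = \<phi> x z (g \<cdot>\<^bsub>D\<^esub> h')"
      by (simp add: adj_nat_right[OF x h'(1) gH] h'(2) h(2))
    finally have "g \<cdot>\<^bsub>D\<^esub> h' = zero_arr D (on_obj L x) z"
      using adj_inj[OF x D.zero_arr_Hom[OF Lx o(2)] D.cmp_Hom[OF h'(1) gH]] by simp
    then obtain u where u: "u \<in> Hom D (on_obj L x) w" "k \<cdot>\<^bsub>D\<^esub> u = h'"
      using D.is_kernel_ex1[OF k, of h' "on_obj L x"] h'(1) by (auto simp: w_y_z_def)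
    have "on_arr R k \<cdot>\<^bsub>C\<^esub> \<phi> x w u = h"
      using adj_nat_right[OF x u(1) kH] u(2) h'(2) by simp
    then show "\<exists>u. u \<in> Hom C x (on_obj R w) \<and> on_arr R k \<cdot>\<^bsub>C\<^esub> u = h"
      using adj_Hom[OF x u(1)] by blast
  next
    fix x u v
    assume u: "u \<in> Hom C x (on_obj R w)" and v: "v \<in> Hom C x (on_obj R w)"
      and eq: "on_arr R k \<cdot>\<^bsub>C\<^esub> u = on_arr R k \<cdot>\<^bsub>C\<^esub> v"
    have x: "x \<in> obj C" by (rule C.Hom_obj(1)[OF u])
    obtain u' where u': "u' \<in> Hom D (on_obj L x) w" "\<phi> x w u' = u"
      by (rule adj_surj[OF o(3) u])
    obtain v' where v': "v' \<in> Hom D (on_obj L x) w" "\<phi> x w v' = v"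
      by (rule adj_surj[OF o(3) v])
    have "\<phi> x y (k \<cdot>\<^bsub>D\<^esub> u') = \<phi> x y (k \<cdot>\<^bsub>D\<^esub> v')"
      by (simp add: adj_nat_right[OF x u'(1) kH] adj_nat_right[OF x v'(1) kH] u'(2) v'(2) eq)
    then have "k \<cdot>\<^bsub>D\<^esub> u' = k \<cdot>\<^bsub>D\<^esub> v'"
      by (rule adj_inj[OF x D.cmp_Hom[OF u'(1) kH] D.cmp_Hom[OF v'(1) kH]])
    then have "u' = v'"
      using D.is_kernel_inj[OF k, of u' "on_obj L x" v'] u'(1) v'(1) by (simp add: w_y_z_def)
    then show "u = v" using u'(2) v'(2) by simp
  qed
qed

end

lemma right_adjoint_left_exact:
  assumes C: "abelian_category C" and D: "abelian_category D"
    and adj: "adjunction C D L R \<phi>" and R: "additive_functor D C R"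
  shows "left_exact_functor D C R"
proof -
  interpret C: abelian_category C by fact
  interpret D: abelian_category D by fact
  show ?thesis
    unfolding left_exact_functor_def C.left_exact_seq_iff_kernel D.left_exact_seq_iff_kernel
    using R right_adjoint_preserves_kernel[OF adj C.preadditive_category_axioms
        D.preadditive_category_axioms R]
    by blast
qed

text \<open>Right adjoints compose in the reverse order. An arrow \<open>u\<close> of
  \<open>C\<close> crosses \<open>\<psi>\<close> as \<open>on_arr L u\<close> and then
  \<open>\<phi>\<close> as \<open>u\<close>; an arrow \<open>v\<close> of \<open>E\<close> comes out
  of \<open>\<psi>\<close> as \<open>on_arr S v\<close> and then out of \<open>\<phi>\<close> under
  \<open>R\<close>.\<close>

lemma adjunction_comp:
  assumes L: "adjunction C D L R \<phi>" and K: "adjunction D E K S \<psi>"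
  shows "adjunction C E (K \<circ>\<^sub>F L) (R \<circ>\<^sub>F S) (comp_adj L \<phi> S \<psi>)"
  unfolding adjunction_def
proof (intro conjI ballI)
  note fL = adj_functors[OF L] and fK = adj_functors[OF K]
  show "is_functor C E (K \<circ>\<^sub>F L)" by (rule is_functor_comp[OF fK(1) fL(1)])
  show "is_functor E C (R \<circ>\<^sub>F S)" by (rule is_functor_comp[OF fL(2) fK(2)])
  {
    fix x z assume x: "x \<in> obj C" and z: "z \<in> obj E"
    note Lx = functor_obj[OF fL(1) x] and Sz = functor_obj[OF fK(2) z]
    show "bij_betw (comp_adj L \<phi> S \<psi> x z) (Hom E (on_obj (K \<circ>\<^sub>F L) x) z)
        (Hom C x (on_obj (R \<circ>\<^sub>F S) z))"
      using bij_betw_trans[OF adj_bij[OF K Lx z] adj_bij[OF L x Sz]]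
      by (simp add: comp_fctr_def comp_adj_def[abs_def] comp_def)
  next
    fix x x' z f u
    assume "x \<in> obj C" and f: "f \<in> Hom E (on_obj (K \<circ>\<^sub>F L) x) z" and u: "u \<in> Hom C x' x"
    then show "comp_adj L \<phi> S \<psi> x' z (f \<cdot>\<^bsub>E\<^esub> on_arr (K \<circ>\<^sub>F L) u)
        = comp_adj L \<phi> S \<psi> x z f \<cdot>\<^bsub>C\<^esub> u"
      using adj_nat_left[OF K _ functor_Hom[OF fL(1) u]]
        adj_nat_left[OF L adj_Hom[OF K functor_obj[OF fL(1)]] u]
      by (simp add: comp_fctr_def comp_adj_def)
  next
    fix x z z' f v
    assume x: "x \<in> obj C" and f: "f \<in> Hom E (on_obj (K \<circ>\<^sub>F L) x) z" and v: "v \<in> Hom E z z'"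
    note Lx = functor_obj[OF fL(1) x]
    have f': "f \<in> Hom E (on_obj K (on_obj L x)) z" using f by (simp add: comp_fctr_def)
    show "comp_adj L \<phi> S \<psi> x z' (v \<cdot>\<^bsub>E\<^esub> f)
        = on_arr (R \<circ>\<^sub>F S) v \<cdot>\<^bsub>C\<^esub> comp_adj L \<phi> S \<psi> x z f"
      using adj_nat_right[OF K Lx f' v]
        adj_nat_right[OF L x adj_Hom[OF K Lx f'] functor_Hom[OF fK(2) v]]
      by (simp add: comp_fctr_def comp_adj_def)
  }
qed

section \<open>Transposes of transformations into the identity\<close>

context
  fixes C :: "('o, 'm) precat" and T U \<phi> \<sigma>
  assumes adj: "adjunction C C T U \<phi>" and nat: "natural_transformation C C T id_fctr \<sigma>"
begin

lemma transpose_transformation_Hom: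
  assumes "x \<in> obj C" shows "\<sigma> x \<in> Hom C (on_obj T x) x"
  using nat assms by (simp add: natural_transformation_def id_fctr_def)

text \<open>Naturality of \<open>\<sigma>\<close> rewrites \<open>f \<cdot> \<sigma> x\<close> as
  \<open>\<sigma> y \<cdot> on_arr T f\<close>, and naturality of \<open>\<phi>\<close> in its first
  argument then takes \<open>f\<close> outside.\<close>

lemma conjugate_transpose: "conjugate C C \<phi> id_fctr id_adj \<sigma> (\<lambda>y. \<phi> y y (\<sigma> y))"
  unfolding conjugate_def id_adj_def
proof (intro ballI)
  fix x y f assume x: "x \<in> obj C" and y: "y \<in> obj C" and f: "f \<in> Hom C (on_obj id_fctr x) y"
  then have f: "f \<in> Hom C x y" by (simp add: id_fctr_def)
  have "f \<cdot>\<^bsub>C\<^esub> \<sigma> x = \<sigma> y \<cdot>\<^bsub>C\<^esub> on_arr T f"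
    using nat x y f by (simp add: natural_transformation_def id_fctr_def)
  then show "\<phi> x y (f \<cdot>\<^bsub>C\<^esub> \<sigma> x) = \<phi> y y (\<sigma> y) \<cdot>\<^bsub>C\<^esub> f"
    using adj_nat_left[OF adj transpose_transformation_Hom[OF y] f] by simp
qed

text \<open>Both sides of the naturality square equal
  \<open>\<phi> x y (f \<cdot> \<sigma> x)\<close>: one by conjugacy, the other by naturality of
  \<open>\<phi>\<close> in its second argument.\<close>

lemma natural_transpose: "natural_transformation C C id_fctr U (\<lambda>y. \<phi> y y (\<sigma> y))"
proof -
  have "\<phi> y y (\<sigma> y) \<cdot>\<^bsub>C\<^esub> f = on_arr U f \<cdot>\<^bsub>C\<^esub> \<phi> x x (\<sigma> x)"
    if x: "x \<in> obj C" and y: "y \<in> obj C" and f: "f \<in> Hom C x y" for x y f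
    using conjugate_transpose x y f adj_nat_right[OF adj x transpose_transformation_Hom[OF x] f]
    by (simp add: conjugate_def id_adj_def id_fctr_def)
  moreover have "category C" using adj_functors[OF adj] by (simp add: is_functor_def)
  ultimately show ?thesis
    using is_functor_id[of C] adj_functors(2)[OF adj] adj_Hom[OF adj _ transpose_transformation_Hom]
    by (simp add: natural_transformation_def id_fctr_def)
qed

end

section \<open>Compatibility of the transposes in a wide Morita context\<close>

lemma (in right_wide_morita_context) right_wide_morita_context_swap:
  "right_wide_morita_context B A G F \<rho> \<eta>"
  by (intro right_wide_morita_context.intro right_wide_morita_context_axioms.intro
      A.abelian_category_axioms B.abelian_category_axioms
      F_right_exact G_right_exact \<eta>_natural \<rho>_natural G_\<eta> F_\<rho>)

lemma (in right_wide_morita_context) transpose_compatible: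
  assumes FF': "adjunction B A F F' \<phi>" and GG': "adjunction A B G G' \<psi>" and b: "b \<in> obj B"
  shows "comp_adj G \<psi> F' \<phi> (on_obj G' b) (on_obj G' b) (\<eta> (on_obj G' b))
    = on_arr G' (comp_adj F \<phi> G' \<psi> b b (\<rho> b))"
proof -
  let ?a = "on_obj G' b"
  have fG: "is_functor A B G" "is_functor B A G'" and fF: "is_functor B A F" "is_functor A B F'"
    using adj_functors[OF GG'] adj_functors[OF FF'] by simp_all
  have a: "?a \<in> obj A" by (rule functor_obj[OF fG(2) b])
  have Ga: "on_obj G ?a \<in> obj B" by (rule functor_obj[OF fG(1) a])
  have Fb: "on_obj F b \<in> obj A" by (rule functor_obj[OF fF(1) b])
  have \<rho>H: "\<rho> b \<in> Hom B (on_obj G (on_obj F b)) b"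
    using \<rho>_natural b by (simp add: natural_transformation_def comp_fctr_def id_fctr_def)
  have \<eta>H: "\<eta> ?a \<in> Hom A (on_obj F (on_obj G ?a)) ?a"
    using \<eta>_natural a by (simp add: natural_transformation_def comp_fctr_def id_fctr_def)
  \<comment> \<open>The counit of \<open>G \<stileturn> G'\<close> at \<open>b\<close>, obtained as
    the arrow whose transpose is the identity.\<close>
  obtain \<epsilon> where \<epsilon>: "\<epsilon> \<in> Hom B (on_obj G ?a) b" "\<psi> ?a b \<epsilon> = ident A ?a"
    by (rule adj_surj[OF GG' b A.ident_Hom[OF a]])
  note F\<epsilon> = functor_Hom[OF fF(1) \<epsilon>(1)]
  note \<psi>\<rho> = adj_Hom[OF GG' Fb \<rho>H]
  note \<rho>' = adj_Hom[OF FF' b \<psi>\<rho>]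
  \<comment> \<open>Naturality of \<open>\<rho>\<close> at \<open>\<epsilon>\<close> gives
    \<open>\<rho>\<close> at \<open>on_obj G ?a\<close> on the right, and the compatibility of the
    right context replaces it by \<open>on_arr G (\<eta> ?a)\<close>.\<close>
  have nat: "\<rho> b \<cdot>\<^bsub>B\<^esub> on_arr G (on_arr F \<epsilon>) = \<epsilon> \<cdot>\<^bsub>B\<^esub> on_arr G (\<eta> ?a)"
    using \<rho>_natural Ga b \<epsilon>(1) G_\<eta>[OF a]
    by (simp add: natural_transformation_def comp_fctr_def id_fctr_def)
  \<comment> \<open>The identity is inserted as the transpose of \<open>\<epsilon>\<close>. Then
    \<open>\<epsilon>\<close> moves inward through \<open>\<psi>\<close>, \<open>\<phi>\<close> and
    the inner \<open>\<psi>\<close>, until \<open>nat\<close> applies; moving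
    \<open>\<eta> ?a\<close> out of the inner \<open>\<psi>\<close> leaves the identity in front of
    it.\<close>
  have "on_arr G' (comp_adj F \<phi> G' \<psi> b b (\<rho> b))
      = on_arr G' (\<phi> b ?a (\<psi> (on_obj F b) b (\<rho> b))) \<cdot>\<^bsub>A\<^esub> \<psi> ?a b \<epsilon>"
    using A.ident_right[OF functor_Hom[OF fG(2) \<rho>']] by (simp add: comp_adj_def \<epsilon>(2))
  also have "\<dots> = \<psi> ?a (on_obj F' ?a) (\<phi> b ?a (\<psi> (on_obj F b) b (\<rho> b)) \<cdot>\<^bsub>B\<^esub> \<epsilon>)"
    by (rule adj_nat_right[OF GG' a \<epsilon>(1) \<rho>', symmetric])
  also have "\<phi> b ?a (\<psi> (on_obj F b) b (\<rho> b)) \<cdot>\<^bsub>B\<^esub> \<epsilon>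
      = \<phi> (on_obj G ?a) ?a (\<psi> (on_obj F b) b (\<rho> b) \<cdot>\<^bsub>A\<^esub> on_arr F \<epsilon>)"
    by (rule adj_nat_left[OF FF' \<psi>\<rho> \<epsilon>(1), symmetric])
  also have "\<psi> (on_obj F b) b (\<rho> b) \<cdot>\<^bsub>A\<^esub> on_arr F \<epsilon>
      = \<psi> (on_obj F (on_obj G ?a)) b (\<epsilon> \<cdot>\<^bsub>B\<^esub> on_arr G (\<eta> ?a))"
    using adj_nat_left[OF GG' \<rho>H F\<epsilon>] nat by simp
  also have "\<dots> = \<eta> ?a"
    using adj_nat_left[OF GG' \<epsilon>(1) \<eta>H] \<epsilon>(2) A.ident_left[OF \<eta>H] by simp
  finally show ?thesis by (simp add: comp_adj_def)
qed

text \<open>The \<open>conjugate\<close> clauses make precise that the new transformations are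
  induced by the context. The identity functor is adjoint to itself via \<open>id_adj\<close>, and
  evaluating the clauses at identity arrows determines \<open>\<eta>'\<close> and
  \<open>\<rho>'\<close> on objects.\<close>

theorem proposition2p12:
  fixes A :: "('oa, 'ma) precat" and B :: "('ob, 'mb) precat"
    and F :: "('ob, 'mb, 'oa, 'ma) fctr" and G :: "('oa, 'ma, 'ob, 'mb) fctr"
    and F' :: "('oa, 'ma, 'ob, 'mb) fctr" and G' :: "('ob, 'mb, 'oa, 'ma) fctr"
    and \<eta> :: "'oa \<Rightarrow> 'ma" and \<rho> :: "'ob \<Rightarrow> 'mb"
    and \<phi> :: "'ob \<Rightarrow> 'oa \<Rightarrow> 'ma \<Rightarrow> 'mb" and \<psi> :: "'oa \<Rightarrow> 'ob \<Rightarrow> 'mb \<Rightarrow> 'ma"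
  assumes "right_wide_morita_context A B F G \<eta> \<rho>"
    and "additive_functor A B F'" and "additive_functor B A G'"
    and "adjunction B A F F' \<phi>" and "adjunction A B G G' \<psi>"
  shows "\<exists>\<eta>' \<rho>'.
    conjugate A A (comp_adj G \<psi> F' \<phi>) id_fctr id_adj \<eta> \<eta>' \<and>
    conjugate B B (comp_adj F \<phi> G' \<psi>) id_fctr id_adj \<rho> \<rho>' \<and>
    left_wide_morita_context A B F' G' \<eta>' \<rho>'"
proof (intro exI conjI)
  interpret right_wide_morita_context A B F G \<eta> \<rho> by (rule assms(1))
  interpret op: right_wide_morita_context B A G F \<rho> \<eta> by (rule right_wide_morita_context_swap)
  let ?\<eta>' = "\<lambda>a. comp_adj G \<psi> F' \<phi> a a (\<eta> a)" and ?\<rho>' = "\<lambda>b. comp_adj F \<phi> G' \<psi> b b (\<rho> b)"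
  note FG = adjunction_comp[OF assms(5,4)] and GF = adjunction_comp[OF assms(4,5)]
  show "conjugate A A (comp_adj G \<psi> F' \<phi>) id_fctr id_adj \<eta> ?\<eta>'"
    by (rule conjugate_transpose[OF FG \<eta>_natural])
  show "conjugate B B (comp_adj F \<phi> G' \<psi>) id_fctr id_adj \<rho> ?\<rho>'"
    by (rule conjugate_transpose[OF GF \<rho>_natural])
  show "left_wide_morita_context A B F' G' ?\<eta>' ?\<rho>'"
  proof (intro left_wide_morita_context.intro left_wide_morita_context_axioms.intro
      A.abelian_category_axioms B.abelian_category_axioms)
    show "left_exact_functor A B F'"
      by (rule right_adjoint_left_exact[OF B.abelian_category_axioms A.abelian_category_axioms
            assms(4,2)])
    show "left_exact_functor B A G'"
      by (rule right_adjoint_left_exact[OF A.abelian_category_axioms B.abelian_category_axioms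
            assms(5,3)])
    show "natural_transformation A A id_fctr (G' \<circ>\<^sub>F F') ?\<eta>'"
      by (rule natural_transpose[OF FG \<eta>_natural])
    show "natural_transformation B B id_fctr (F' \<circ>\<^sub>F G') ?\<rho>'"
      by (rule natural_transpose[OF GF \<rho>_natural])
  \<comment> \<open>The equality for \<open>\<eta>'\<close> at \<open>G'\<close> comes from the
    given context, the one for \<open>\<rho>'\<close> at \<open>F'\<close> from the exchanged
    one.\<close>
  qed (rule transpose_compatible[OF assms(4,5)] op.transpose_compatible[OF assms(5,4)], assumption)+
qed

end
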